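(* Let $N\ge 3$. For $p,q,m,s>0$ and $\rho\in C(\mathbb{R}^N)$, $\rho\ge 0$, consider the system $$ (S)\quad \begin{cases} -\Delta u=\dfrac{u^p}{v^q}+\rho(x) & \text{in }\mathbb{R}^N,\\[2mm] -\Delta v=\dfrac{u^m}{v^s} & \text{in }\mathbb{R}^N,\\[2mm] u(x),v(x)\to 0 & \text{as }|x|\to\infty. \end{cases} $$ (i) If $0<p\le\frac{N}{N-2}$, then $(S)$ has no positive solutions for all $q,m,s>0$ and any function $\rho\in C(\mathbb{R}^N)$, $\rho\ge 0$. (ii) Conversely, for all $p>\frac{N}{N-2}$ there exist $q,m,s>0$ and a continuous function $\rho\in C(\mathbb{R}^N)$, $\rho\ge 0$, such that $(S)$ has a positive solution.
   Context: A positive solution is a pair of functions $u,v\in C^2(\mathbb{R}^N)$ with $u,v>0$ satisfying the system at every point of $\mathbb{R}^N$ together with the decay condition at infinity. *)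

theory Defs
  imports "HOL-Analysis.Analysis"
begin

text \<open>Partial derivative along the \<open>i\<close>-th coordinate axis. The value is meaningful only where the
  derivative exists; \<open>C1_function\<close> and \<open>C2_function\<close> require existence explicitly.\<close>

definition partial_deriv :: "'n::finite \<Rightarrow> (real^'n \<Rightarrow> real) \<Rightarrow> real^'n \<Rightarrow> real" where
  "partial_deriv i f x = deriv (\<lambda>t. f (x + t *\<^sub>R axis i 1)) 0"

definition C1_function :: "(real^'n::finite \<Rightarrow> real) \<Rightarrow> bool" where
  "C1_function f \<longleftrightarrow> continuous_on UNIV f \<and>
     (\<forall>i. (\<forall>x. (\<lambda>t. f (x + t *\<^sub>R axis i 1)) field_differentiable (at 0)) \<and>
          continuous_on UNIV (partial_deriv i f))"

definition C2_function :: "(real^'n::finite \<Rightarrow> real) \<Rightarrow> bool" where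
  "C2_function f \<longleftrightarrow> C1_function f \<and> (\<forall>i. C1_function (partial_deriv i f))"

definition laplacian :: "(real^'n::finite \<Rightarrow> real) \<Rightarrow> real^'n \<Rightarrow> real" where
  "laplacian f x = (\<Sum>i\<in>UNIV. partial_deriv i (partial_deriv i f) x)"

definition positive_solution ::
  "real \<Rightarrow> real \<Rightarrow> real \<Rightarrow> real \<Rightarrow> (real^'n::finite \<Rightarrow> real) \<Rightarrow>
   (real^'n \<Rightarrow> real) \<Rightarrow> (real^'n \<Rightarrow> real) \<Rightarrow> bool" where
  "positive_solution p q m s \<rho> u v \<longleftrightarrow>
     C2_function u \<and> C2_function v \<and>
     (\<forall>x. u x > 0) \<and> (\<forall>x. v x > 0) \<and>
     (\<forall>x. - laplacian u x = u x powr p / v x powr q + \<rho> x) \<and>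
     (\<forall>x. - laplacian v x = u x powr m / v x powr s) \<and>
     (u \<longlongrightarrow> 0) at_infinity \<and> (v \<longlongrightarrow> 0) at_infinity"

end

(* (i) Since u and v are bounded, u satisfies -Laplace u >= c u^P with the critical exponent
   P = N/(N-2). By the maximum principle, m |x|^(2-N) <= u for |x| >= 1. Such a bound for
   |x| >= r makes -Laplace u >= c m^P |x|^(-N) there, and comparison with
   |x|^(2-N) (m + b log(|x|/r)), where b is a multiple of m^P, shows that m can be doubled at the
   expense of increasing log r by a constant times m^(-2/(N-2)). These increments sum to a
   geometric series, so u is infinite at a finite radius.

   (ii) With v = l (1+|x|^2)^(-(N-2)/2), -Laplace v is a multiple of (1+|x|^2)^(-(N+2)/2), and for
   s = 1 the second equation holds with u = K (1+|x|^2)^(-a), m = N/a. For 1/(p-1) < a < (N-2)/2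
   both q and K can be chosen small enough that -Laplace u >= u^p/v^q; the difference is rho. *)
theory Submission
  imports Defs "HOL-Real_Asymp.Real_Asymp"
begin

section \<open>Second derivatives along coordinate axes and radial functions\<close>

text \<open>Since \<open>f' 0 = 0\<close>, a negative \<open>d\<close> would make \<open>f'\<close>
  negative just to the right of 0, and the mean value theorem would put \<open>f\<close> below
  \<open>f 0\<close> there.\<close>

lemma second_deriv_nonneg_at_local_min:
  fixes f f' :: "real \<Rightarrow> real"
  assumes "eventually (\<lambda>t. (f has_real_derivative f' t) (at t)) (nhds 0)"
    and "(f' has_real_derivative d) (at 0)"
    and "eventually (\<lambda>t. f 0 \<le> f t) (nhds 0)"
  shows "d \<ge> 0"
proof (rule ccontr)
  assume "\<not> d \<ge> 0"
  then have "d < 0" by simp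
  obtain e1 where e1: "e1 > 0" "\<And>t. \<bar>t\<bar> < e1 \<Longrightarrow> (f has_real_derivative f' t) (at t)"
    using assms(1) by (auto simp: eventually_nhds_metric dist_real_def)
  obtain e2 where e2: "e2 > 0" "\<And>t. \<bar>t\<bar> < e2 \<Longrightarrow> f 0 \<le> f t"
    using assms(3) by (auto simp: eventually_nhds_metric dist_real_def)
  have f'0: "f' 0 = 0"
    using DERIV_local_min[OF e1(2)[of 0], of e2] e1 e2 by auto
  obtain e3 where e3: "e3 > 0" "\<And>h. 0 < h \<Longrightarrow> h < e3 \<Longrightarrow> f' h < 0"
    using DERIV_neg_dec_right[OF assms(2) \<open>d < 0\<close>] f'0 by auto
  define b where "b = min e1 (min e2 e3) / 2"
  have b: "0 < b" "b < e1" "b < e2" "b < e3"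
    using e1(1) e2(1) e3(1) by (auto simp: b_def)
  obtain z where z: "0 < z" "z < b" "f b - f 0 = (b - 0) * f' z"
    using MVT2[of 0 b f f'] b e1(2) by (auto simp: abs_if)
  have "f b < f 0"
    using z e3(2)[of z] b mult_pos_neg[of b "f' z"] by auto
  with e2(2)[of b] b show False by auto
qed

text \<open>A pointwise notion, so that it also covers barriers that are singular at the origin. It
  asks only for what the second derivative test uses on each axis line through
  \<open>x\<close>.\<close>

definition twice_partially_differentiable :: "(real^'n::finite \<Rightarrow> real) \<Rightarrow> real^'n \<Rightarrow> bool" where
  "twice_partially_differentiable f x \<longleftrightarrow> (\<forall>i.
     eventually (\<lambda>t. ((\<lambda>s. f (x + s *\<^sub>R axis i 1)) has_real_derivative
        partial_deriv i f (x + t *\<^sub>R axis i 1)) (at t)) (nhds 0) \<and>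
     ((\<lambda>t. partial_deriv i f (x + t *\<^sub>R axis i 1)) has_real_derivative
        partial_deriv i (partial_deriv i f) x) (at 0))"

lemma has_derivative_along_axis_shift:
  fixes f :: "real^'n::finite \<Rightarrow> real"
  assumes "((\<lambda>s. f ((x + t *\<^sub>R axis i 1) + s *\<^sub>R axis i 1)) has_real_derivative d) (at 0)"
  shows "((\<lambda>s. f (x + s *\<^sub>R axis i 1)) has_real_derivative d) (at t)"
proof -
  have "((\<lambda>s. f (x + s *\<^sub>R axis i 1)) has_real_derivative d) (at (t + 0))
      \<longleftrightarrow> ((\<lambda>s. f (x + (s + t) *\<^sub>R axis i 1)) has_real_derivative d) (at 0)"
    by (subst DERIV_shift [symmetric]) (simp add: add.commute)
  then show ?thesis
    using assms by (simp add: algebra_simps)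
qed

lemma C1_function_partial_deriv:
  assumes "C1_function f"
  shows "((\<lambda>s. f (x + s *\<^sub>R axis i 1)) has_real_derivative
           partial_deriv i f (x + t *\<^sub>R axis i 1)) (at t)"
proof (rule has_derivative_along_axis_shift)
  have "(\<lambda>s. f ((x + t *\<^sub>R axis i 1) + s *\<^sub>R axis i 1)) field_differentiable at 0"
    using assms unfolding C1_function_def by blast
  then show "((\<lambda>s. f ((x + t *\<^sub>R axis i 1) + s *\<^sub>R axis i 1)) has_real_derivative
      partial_deriv i f (x + t *\<^sub>R axis i 1)) (at 0)"
    by (simp only: partial_deriv_def DERIV_deriv_iff_field_differentiable)
qed

lemma C2_function_twice_partially_differentiable:
  assumes "C2_function f"
  shows "twice_partially_differentiable f x"
  unfolding twice_partially_differentiable_def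
proof (intro allI conjI)
  fix i
  show "eventually (\<lambda>t. ((\<lambda>s. f (x + s *\<^sub>R axis i 1)) has_real_derivative
        partial_deriv i f (x + t *\<^sub>R axis i 1)) (at t)) (nhds 0)"
    using assms by (auto simp: C2_function_def intro!: always_eventually C1_function_partial_deriv)
  show "((\<lambda>t. partial_deriv i f (x + t *\<^sub>R axis i 1)) has_real_derivative
        partial_deriv i (partial_deriv i f) x) (at 0)"
    using C1_function_partial_deriv[of "partial_deriv i f" x i 0] assms
    by (auto simp: C2_function_def)
qed

text \<open>The restriction of \<open>u - w\<close> to each axis line has a local minimum at
  \<open>x\<close>, so the one-variable test applies to each summand of the Laplacian.\<close>

lemma laplacian_le_at_local_min:
  fixes u w :: "real^'n::finite \<Rightarrow> real"
  assumes u: "twice_partially_differentiable u x" and w: "twice_partially_differentiable w x"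
    and min: "eventually (\<lambda>y. u x - w x \<le> u y - w y) (nhds x)"
  shows "laplacian w x \<le> laplacian u x"
  unfolding laplacian_def
proof (rule sum_mono)
  fix i :: 'n
  let ?l = "\<lambda>t::real. x + t *\<^sub>R axis i (1::real)"
  have tend: "filterlim ?l (nhds x) (nhds 0)"
  proof -
    have "continuous_on UNIV ?l" by (intro continuous_intros)
    then have "isCont ?l 0" by (auto simp: continuous_on_eq_continuous_at)
    then have "(?l \<longlongrightarrow> ?l 0) (nhds 0)"
      unfolding isCont_def by (rule iffD1[OF tendsto_at_iff_tendsto_nhds])
    then show ?thesis by simp
  qed
  have "0 \<le> partial_deriv i (partial_deriv i u) x - partial_deriv i (partial_deriv i w) x"
  proof (rule second_deriv_nonneg_at_local_min)
    show "eventually (\<lambda>t. ((\<lambda>s. u (?l s) - w (?l s)) has_real_derivative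
        partial_deriv i u (?l t) - partial_deriv i w (?l t)) (at t)) (nhds 0)"
      using u[unfolded twice_partially_differentiable_def, rule_format, of i, THEN conjunct1]
        w[unfolded twice_partially_differentiable_def, rule_format, of i, THEN conjunct1]
      by eventually_elim (rule DERIV_diff)
    show "((\<lambda>t. partial_deriv i u (?l t) - partial_deriv i w (?l t)) has_real_derivative
        partial_deriv i (partial_deriv i u) x - partial_deriv i (partial_deriv i w) x) (at 0)"
      using u[unfolded twice_partially_differentiable_def, rule_format, of i, THEN conjunct2]
        w[unfolded twice_partially_differentiable_def, rule_format, of i, THEN conjunct2]
      by (rule DERIV_diff)
    show "eventually (\<lambda>t. u (?l 0) - w (?l 0) \<le> u (?l t) - w (?l t)) (nhds 0)"
      using eventually_compose_filterlim[OF min tend] by simp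
  qed
  then show "partial_deriv i (partial_deriv i w) x \<le> partial_deriv i (partial_deriv i u) x"
    by simp
qed

section \<open>Radial functions, written as functions of |x|^2\<close>

lemma axis_line_inner_has_derivative:
  fixes x :: "real^'n::finite"
  assumes "(G has_real_derivative d) (at ((x + t *\<^sub>R axis i 1) \<bullet> (x + t *\<^sub>R axis i 1)))"
  shows "((\<lambda>s. G ((x + s *\<^sub>R axis i 1) \<bullet> (x + s *\<^sub>R axis i 1))) has_real_derivative
            2 * (x + t *\<^sub>R axis i 1) $ i * d) (at t)"
proof -
  have "((\<lambda>s. (x + s *\<^sub>R axis i 1) \<bullet> (x + s *\<^sub>R axis i 1)) has_real_derivative
            2 * (x + t *\<^sub>R axis i 1) $ i) (at t)"
    by (simp add: inner_add_left inner_add_right inner_axis inner_axis')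
       (auto intro!: derivative_eq_intros simp: axis_def)
  from DERIV_chain2[OF assms this] show ?thesis by (simp add: mult.commute)
qed

lemma partial_deriv_radial:
  fixes x :: "real^'n::finite"
  assumes "(G has_real_derivative d) (at (x \<bullet> x))"
  shows "partial_deriv i (\<lambda>x. G (x \<bullet> x)) x = 2 * x $ i * d"
  unfolding partial_deriv_def
  by (rule DERIV_imp_deriv) (use axis_line_inner_has_derivative[of G d x 0 i] assms in simp)

text \<open>First partial derivatives of radial functions have the form of a coordinate times a
  radial function; this lemma differentiates them once more.\<close>

lemma partial_deriv_radial_line:
  fixes x :: "real^'n::finite"
  assumes "(G has_real_derivative d) (at (x \<bullet> x))"
  shows "((\<lambda>t. (x + t *\<^sub>R axis j 1) $ i * G ((x + t *\<^sub>R axis j 1) \<bullet> (x + t *\<^sub>R axis j 1)))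
     has_real_derivative (if i = j then G (x \<bullet> x) else 0) + 2 * x $ i * x $ j * d) (at 0)"
proof -
  have "((\<lambda>t. (x + t *\<^sub>R axis j 1) $ i) has_real_derivative (if i = j then 1 else 0)) (at 0)"
    by (auto intro!: derivative_eq_intros simp: axis_def)
  from DERIV_mult[OF this axis_line_inner_has_derivative[of G d x 0 j]] assms
  show ?thesis by (simp add: algebra_simps split: if_splits)
qed

text \<open>Using \<open>x \<bullet> x\<close> instead of the norm keeps the profile smooth at the
  origin. The open set \<open>S\<close> allows profiles defined on part of the line:
  \<open>{0<..}\<close> for the singular barriers, \<open>{-1<..}\<close> for powers of 1 +
  |x|^2.\<close>

context
  fixes G G' G'' :: "real \<Rightarrow> real" and S :: "real set"
  assumes S: "open S"
    and G': "\<And>y. y \<in> S \<Longrightarrow> (G has_real_derivative G' y) (at y)"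
    and G'': "\<And>y. y \<in> S \<Longrightarrow> (G' has_real_derivative G'' y) (at y)"
begin

lemma eventually_line_inner_in:
  fixes x :: "real^'n::finite"
  assumes "x \<bullet> x \<in> S"
  shows "eventually (\<lambda>t::real. (x + t *\<^sub>R axis i 1) \<bullet> (x + t *\<^sub>R axis i 1) \<in> S) (nhds 0)"
proof -
  have "continuous_on UNIV (\<lambda>t::real. (x + t *\<^sub>R axis i 1) \<bullet> (x + t *\<^sub>R axis i 1))"
    by (intro continuous_intros)
  then have "open ((\<lambda>t::real. (x + t *\<^sub>R axis i 1) \<bullet> (x + t *\<^sub>R axis i 1)) -` S)"
    using S open_vimage by blast
  then show ?thesis
    using assms by (auto simp: eventually_nhds intro!: exI[of _ "(\<lambda>t::real. (x + t *\<^sub>R axis i 1) \<bullet> (x + t *\<^sub>R axis i 1)) -` S"])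
qed

lemma second_partial_deriv_radial_line:
  fixes x :: "real^'n::finite"
  assumes "x \<bullet> x \<in> S"
  shows "((\<lambda>t. partial_deriv i (\<lambda>x. G (x \<bullet> x)) (x + t *\<^sub>R axis j 1)) has_real_derivative
            (if i = j then 2 * G' (x \<bullet> x) else 0) + 4 * x $ i * x $ j * G'' (x \<bullet> x)) (at 0)"
proof -
  have "((\<lambda>t. 2 * ((x + t *\<^sub>R axis j 1) $ i * G' ((x + t *\<^sub>R axis j 1) \<bullet> (x + t *\<^sub>R axis j 1))))
     has_real_derivative 2 * ((if i = j then G' (x \<bullet> x) else 0) + 2 * x $ i * x $ j * G'' (x \<bullet> x))) (at 0)"
    by (intro DERIV_cmult partial_deriv_radial_line G'' assms)
  \<comment> \<open>The formula for the first derivative is known only while the line stays over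
    \<open>S\<close>; agreement near \<open>t = 0\<close> suffices for differentiation
    there.\<close>
  moreover have "eventually (\<lambda>t. partial_deriv i (\<lambda>x. G (x \<bullet> x)) (x + t *\<^sub>R axis j 1) =
      2 * ((x + t *\<^sub>R axis j 1) $ i * G' ((x + t *\<^sub>R axis j 1) \<bullet> (x + t *\<^sub>R axis j 1)))) (nhds 0)"
    using eventually_line_inner_in[OF assms, of j]
    by eventually_elim (simp only: partial_deriv_radial[OF G'] mult.assoc)
  ultimately show ?thesis
    by (subst DERIV_cong_ev[OF refl _ refl]) (auto simp: algebra_simps)
qed

lemma second_partial_deriv_radial:
  fixes x :: "real^'n::finite"
  assumes "x \<bullet> x \<in> S"
  shows "partial_deriv j (partial_deriv i (\<lambda>x. G (x \<bullet> x))) x =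
            (if i = j then 2 * G' (x \<bullet> x) else 0) + 4 * x $ i * x $ j * G'' (x \<bullet> x)"
  using second_partial_deriv_radial_line[OF assms]
  unfolding partial_deriv_def[of j] by (rule DERIV_imp_deriv)

text \<open>The Hessian is 2 G' times the identity plus 4 G'' times the matrix of the products x_i
  x_j; this is its trace.\<close>

lemma laplacian_radial:
  fixes x :: "real^'n::finite"
  assumes "x \<bullet> x \<in> S"
  shows "laplacian (\<lambda>x. G (x \<bullet> x)) x = 2 * real CARD('n) * G' (x \<bullet> x) + 4 * (x \<bullet> x) * G'' (x \<bullet> x)"
proof -
  have "laplacian (\<lambda>x. G (x \<bullet> x)) x = (\<Sum>i\<in>UNIV. 2 * G' (x \<bullet> x) + 4 * G'' (x \<bullet> x) * (x $ i * x $ i))"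
    unfolding laplacian_def second_partial_deriv_radial[OF assms] by (simp add: algebra_simps)
  also have "\<dots> = 2 * real CARD('n) * G' (x \<bullet> x) + 4 * G'' (x \<bullet> x) * (x \<bullet> x)"
    by (simp add: sum.distrib inner_vec_def sum_distrib_left)
  finally show ?thesis by (simp add: algebra_simps)
qed

lemma radial_twice_partially_differentiable:
  fixes x :: "real^'n::finite"
  assumes "x \<bullet> x \<in> S"
  shows "twice_partially_differentiable (\<lambda>x. G (x \<bullet> x)) x"
  unfolding twice_partially_differentiable_def
proof (intro allI conjI)
  fix i
  show "eventually (\<lambda>t. ((\<lambda>s. G ((x + s *\<^sub>R axis i 1) \<bullet> (x + s *\<^sub>R axis i 1))) has_real_derivative
        partial_deriv i (\<lambda>x. G (x \<bullet> x)) (x + t *\<^sub>R axis i 1)) (at t)) (nhds 0)"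
    using eventually_line_inner_in[OF assms, of i]
    by eventually_elim
       (simp only: partial_deriv_radial[OF G'] axis_line_inner_has_derivative[OF G'])
  show "((\<lambda>t. partial_deriv i (\<lambda>x. G (x \<bullet> x)) (x + t *\<^sub>R axis i 1)) has_real_derivative
        partial_deriv i (partial_deriv i (\<lambda>x. G (x \<bullet> x))) x) (at 0)"
    unfolding second_partial_deriv_radial[OF assms]
    by (rule second_partial_deriv_radial_line[OF assms])
qed

lemma C2_function_radial:
  assumes nonneg: "\<And>y. y \<ge> 0 \<Longrightarrow> y \<in> S" and cont: "continuous_on S G''"
  shows "C2_function (\<lambda>x::real^'n::finite. G (x \<bullet> x))"
proof -
  have S_inner: "x \<bullet> x \<in> S" for x :: "real^'n" by (simp add: nonneg)
  have cont_radial: "continuous_on UNIV (\<lambda>x::real^'n. H (x \<bullet> x))" if "continuous_on S H" for H :: "real \<Rightarrow> real"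
    by (rule continuous_on_compose2[OF that]) (auto intro!: continuous_intros S_inner)
  have contG: "continuous_on S G" "continuous_on S G'"
    using G' G'' by (meson DERIV_isCont continuous_at_imp_continuous_on)+
  have pd: "partial_deriv i (\<lambda>x. G (x \<bullet> x)) = (\<lambda>x. 2 * x $ i * G' (x \<bullet> x))" for i :: 'n
    by (intro ext partial_deriv_radial G' S_inner)
  have pd2: "partial_deriv j (partial_deriv i (\<lambda>x. G (x \<bullet> x))) =
      (\<lambda>x. (if i = j then 2 * G' (x \<bullet> x) else 0) + 4 * x $ i * x $ j * G'' (x \<bullet> x))" for i j :: 'n
    by (intro ext second_partial_deriv_radial S_inner)
  have "C1_function (\<lambda>x::real^'n. G (x \<bullet> x))"
    unfolding C1_function_def
  proof (intro conjI allI)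
    show "continuous_on UNIV (\<lambda>x::real^'n. G (x \<bullet> x))" by (intro cont_radial contG)
    show "(\<lambda>t. G ((x + t *\<^sub>R axis i 1) \<bullet> (x + t *\<^sub>R axis i 1))) field_differentiable at 0"
      for i and x :: "real^'n"
      using axis_line_inner_has_derivative[OF G'[OF S_inner]] field_differentiable_def by blast
    show "continuous_on UNIV (partial_deriv i (\<lambda>x. G (x \<bullet> x)))" for i :: 'n
      unfolding pd by (intro continuous_intros cont_radial contG)
  qed
  moreover have "C1_function (partial_deriv i (\<lambda>x. G (x \<bullet> x)))" for i :: 'n
    unfolding C1_function_def
  proof (intro conjI allI)
    show "continuous_on UNIV (partial_deriv i (\<lambda>x. G (x \<bullet> x)))"
      unfolding pd by (intro continuous_intros cont_radial contG)
    show "(\<lambda>t. partial_deriv i (\<lambda>x. G (x \<bullet> x)) (x + t *\<^sub>R axis j 1)) field_differentiable at 0" for j x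
      using second_partial_deriv_radial_line[OF S_inner] field_differentiable_def by blast
    show "continuous_on UNIV (partial_deriv j (partial_deriv i (\<lambda>x. G (x \<bullet> x))))" for j
      unfolding pd2 by (cases "i = j") (simp_all, (intro continuous_intros cont_radial contG cont)+)
  qed
  ultimately show ?thesis by (simp add: C2_function_def)
qed

end

section \<open>Comparison in the exterior of a ball\<close>

lemma filterlim_inner_self_at_infinity:
  "filterlim (\<lambda>x::'a::real_inner. x \<bullet> x) at_top at_infinity"
proof -
  have "filterlim (\<lambda>x::'a. norm x ^ 2) at_top at_infinity"
    by (intro filterlim_pow_at_top filterlim_norm_at_top) auto
  then show ?thesis by (simp add: power2_norm_eq_inner)
qed

text \<open>If \<open>u - w\<close> were negative somewhere, decay at infinity would make it attain
  a negative minimum, and the boundary condition would place that minimum in the open exterior. The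
  strict inequality of the Laplacians forbids this.\<close>

lemma exterior_comparison:
  fixes u w :: "real^'n::finite \<Rightarrow> real"
  assumes cont: "continuous_on {x. R \<le> x \<bullet> x} u" "continuous_on {x. R \<le> x \<bullet> x} w"
    and lim: "(u \<longlongrightarrow> 0) at_infinity" "(w \<longlongrightarrow> 0) at_infinity"
    and bdry: "\<And>x. x \<bullet> x = R \<Longrightarrow> w x \<le> u x"
    and diff: "\<And>x. R < x \<bullet> x \<Longrightarrow> twice_partially_differentiable u x"
              "\<And>x. R < x \<bullet> x \<Longrightarrow> twice_partially_differentiable w x"
    and lap: "\<And>x. R < x \<bullet> x \<Longrightarrow> laplacian u x < laplacian w x"
    and x: "R \<le> x \<bullet> x"
  shows "w x \<le> u x"
proof (rule ccontr)
  assume "\<not> w x \<le> u x"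
  then have neg: "u x - w x < 0" by simp
  have "((\<lambda>y. u y - w y) \<longlongrightarrow> 0) at_infinity"
    using tendsto_diff[OF lim] by simp
  then have "eventually (\<lambda>y. u x - w x < u y - w y) at_infinity"
    using neg by (rule order_tendstoD)
  then obtain b where b: "\<And>y. b \<le> norm y \<Longrightarrow> u x - w x < u y - w y"
    by (auto simp: eventually_at_infinity)
  \<comment> \<open>\<open>K\<close> contains \<open>x\<close>, and in the exterior region outside
    \<open>K\<close> the difference exceeds its value at \<open>x\<close>. Hence the minimum over
    the compact set \<open>K\<close> is the minimum over the whole exterior.\<close>
  define K where "K = {y::real^'n. R \<le> y \<bullet> y} \<inter> cball 0 (max b (norm x))"
  have "closed {y::real^'n. R \<le> y \<bullet> y}"
    by (intro closed_Collect_le continuous_intros)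
  then have "compact K" unfolding K_def by (intro closed_Int_compact) simp_all
  moreover have "x \<in> K" using x by (auto simp: K_def)
  moreover have "continuous_on K (\<lambda>y. u y - w y)"
    unfolding K_def by (intro continuous_on_diff) (auto intro: continuous_on_subset[OF cont(1)] continuous_on_subset[OF cont(2)])
  ultimately obtain z where z: "z \<in> K" "\<And>y. y \<in> K \<Longrightarrow> u z - w z \<le> u y - w y"
    using continuous_attains_inf[of K "\<lambda>y. u y - w y"] by blast
  have zx: "u z - w z \<le> u x - w x" using z \<open>x \<in> K\<close> by blast
  have zmin: "u z - w z \<le> u y - w y" if "R \<le> y \<bullet> y" for y
  proof (cases "y \<in> K")
    case False
    then have "b \<le> norm y" using that by (auto simp: K_def)
    then show ?thesis using b[of y] zx by linarith
  next
    case True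
    then show ?thesis by (rule z(2))
  qed
  have "z \<bullet> z \<noteq> R" using bdry[of z] zx neg by auto
  then have zR: "R < z \<bullet> z" using z(1) by (auto simp: K_def)
  have "open {y::real^'n. R < y \<bullet> y}"
    by (intro open_Collect_less continuous_intros)
  then have "eventually (\<lambda>y. u z - w z \<le> u y - w y) (nhds z)"
    using zR zmin by (auto simp: eventually_nhds intro!: exI[of _ "{y. R < y \<bullet> y}"])
  then have "laplacian w z \<le> laplacian u z"
    by (intro laplacian_le_at_local_min diff zR)
  with lap[OF zR] show False by simp
qed

section \<open>Critical supersolutions\<close>

text \<open>With y = |x|^2 this is |x|^(-k) (A + 2 b log |x|); for k = N - 2 and b = 0 it is a
  multiple of the fundamental solution.\<close>

definition log_barrier :: "real \<Rightarrow> real \<Rightarrow> real \<Rightarrow> real \<Rightarrow> real" where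
  "log_barrier k A b y = y powr (- k / 2) * (A + b * ln y)"

text \<open>The derivative has the same shape with new coefficients, so the rule can be applied
  twice.\<close>

lemma powr_times_ln_has_derivative:
  fixes a A b y :: real
  assumes "y > 0"
  shows "((\<lambda>y. y powr a * (A + b * ln y)) has_real_derivative
           y powr (a - 1) * (b + a * A + a * b * ln y)) (at y)"
proof -
  have "y powr a * (b * (1 / y)) = y powr (a - 1) * b"
    using assms by (simp add: powr_diff)
  then show ?thesis
    using assms by (auto intro!: derivative_eq_intros simp: algebra_simps)
qed

lemma
  fixes x :: "real^'n::finite"
  assumes k: "real CARD('n) = k + 2" and x: "x \<bullet> x > 0"
  shows laplacian_log_barrier:
      "laplacian (\<lambda>x::real^'n. log_barrier k A b (x \<bullet> x)) x = - 2 * k * b * (x \<bullet> x) powr (- (k + 2) / 2)"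
    and log_barrier_twice_partially_differentiable:
      "twice_partially_differentiable (\<lambda>x::real^'n. log_barrier k A b (x \<bullet> x)) x"
proof -
  define G' where "G' y = y powr (- k / 2 - 1) * ((b - k / 2 * A) + (- k / 2 * b) * ln y)" for y
  define G'' where "G'' y = y powr (- k / 2 - 2) *
     (- k / 2 * b + (- k / 2 - 1) * (b - k / 2 * A) + (- k / 2 - 1) * (- k / 2 * b) * ln y)" for y
  have G': "(log_barrier k A b has_real_derivative G' y) (at y)" if "y \<in> {0<..}" for y
    using powr_times_ln_has_derivative[of y "- k / 2" A b] that
    unfolding log_barrier_def [abs_def] G'_def by simp
  have G'': "(G' has_real_derivative G'' y) (at y)" if "y \<in> {0<..}" for y
  proof -
    have "- k / 2 - 2 = - k / 2 - 1 - 1" by simp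
    then show ?thesis
      using that unfolding G'_def [abs_def] G''_def
      by (simp only: powr_times_ln_has_derivative greaterThan_iff)
  qed
  have xS: "x \<bullet> x \<in> {0<..}" using x by simp
  show "twice_partially_differentiable (\<lambda>x::real^'n. log_barrier k A b (x \<bullet> x)) x"
    by (rule radial_twice_partially_differentiable[OF _ G' G'' xS]) auto
  define y where "y = x \<bullet> x"
  have y: "y > 0" using x by (simp add: y_def)
  have pw: "y powr (- k / 2 - 1) = y powr (- (k + 2) / 2)"
           "y * y powr (- k / 2 - 2) = y powr (- (k + 2) / 2)"
    using y powr_mult_base[of y "- k / 2 - 2"] by (auto simp: field_simps)
  have "laplacian (\<lambda>x::real^'n. log_barrier k A b (x \<bullet> x)) x = 2 * (k + 2) * G' y + 4 * y * G'' y"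
    using laplacian_radial[OF _ G' G'' xS] k by (simp add: y_def)
  also have "\<dots> = 2 * (k + 2) * y powr (- k / 2 - 1) * ((b - k / 2 * A) + (- k / 2 * b) * ln y) +
      4 * (y * y powr (- k / 2 - 2)) *
        (- k / 2 * b + (- k / 2 - 1) * (b - k / 2 * A) + (- k / 2 - 1) * (- k / 2 * b) * ln y)"
    unfolding G'_def G''_def by (simp only: mult.assoc)
  \<comment> \<open>As 4 (- k/2 - 1) = - 2 (k + 2), the terms with \<open>A\<close> and
    \<open>ln y\<close> cancel, and 4 (- k/2) b is what remains.\<close>
  also have "\<dots> = - 2 * k * b * y powr (- (k + 2) / 2)"
    unfolding pw by (simp add: field_simps)
  finally show "laplacian (\<lambda>x::real^'n. log_barrier k A b (x \<bullet> x)) x = - 2 * k * b * (x \<bullet> x) powr (- (k + 2) / 2)"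
    by (simp add: y_def)
qed

lemma log_barrier_tendsto_0:
  assumes "k > 0"
  shows "((\<lambda>x::'a::real_inner. log_barrier k A b (x \<bullet> x)) \<longlongrightarrow> 0) at_infinity"
proof -
  have 1: "((\<lambda>y::real. y powr (- k / 2)) \<longlongrightarrow> 0) at_top"
    using assms by real_asymp
  have 2: "((\<lambda>y::real. y powr (- k / 2) * ln y) \<longlongrightarrow> 0) at_top"
    using assms by real_asymp
  have "((\<lambda>y::real. A * y powr (- k / 2) + b * (y powr (- k / 2) * ln y)) \<longlongrightarrow> A * 0 + b * 0) at_top"
    by (intro tendsto_intros 1 2)
  then have "(log_barrier k A b \<longlongrightarrow> 0) at_top"
    by (simp add: log_barrier_def [abs_def] algebra_simps)
  then show ?thesis
    using filterlim_inner_self_at_infinity by (rule filterlim_compose)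
qed

section \<open>Nonexistence of positive decaying supersolutions at the critical exponent\<close>

context
  fixes u :: "real^'n::finite \<Rightarrow> real" and k c :: real
  assumes k: "real CARD('n) = k + 2" "k > 0"
    and c: "c > 0"
    and C2: "C2_function u" and pos: "\<And>x. u x > 0" and lim: "(u \<longlongrightarrow> 0) at_infinity"
    and super: "\<And>x. c * u x powr ((k + 2) / k) \<le> - laplacian u x"
begin

text \<open>The condition on \<open>b\<close> places -Laplace of the barrier strictly below the
  lower bound for -Laplace u, as the comparison requires. \<open>R\<close> is a squared
  radius.\<close>

lemma supersolution_ge_log_barrier:
  assumes R: "R > 0" and bdry: "\<And>x. x \<bullet> x = R \<Longrightarrow> log_barrier k A b R \<le> u x"
    and b: "\<And>x. R < x \<bullet> x \<Longrightarrow> 2 * k * b * (x \<bullet> x) powr (- (k + 2) / 2) < c * u x powr ((k + 2) / k)"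
    and x: "R \<le> x \<bullet> x"
  shows "log_barrier k A b (x \<bullet> x) \<le> u x"
proof (rule exterior_comparison[OF _ _ lim log_barrier_tendsto_0[OF k(2)] _ _ _ _ x])
  show "continuous_on {x. R \<le> x \<bullet> x} u"
    using C2 by (auto simp: C2_function_def C1_function_def intro: continuous_on_subset)
  show "continuous_on {x::real^'n. R \<le> x \<bullet> x} (\<lambda>x. log_barrier k A b (x \<bullet> x))"
    unfolding log_barrier_def using R by (intro continuous_intros) auto
  show "log_barrier k A b (x \<bullet> x) \<le> u x" if "x \<bullet> x = R" for x
    using bdry[OF that] that by simp
  show "twice_partially_differentiable u x" for x
    by (rule C2_function_twice_partially_differentiable[OF C2])
  show "twice_partially_differentiable (\<lambda>x. log_barrier k A b (x \<bullet> x)) x" if "R < x \<bullet> x" for x :: "real^'n"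
  proof -
    have "x \<bullet> x > 0" using that R by linarith
    then show ?thesis by (rule log_barrier_twice_partially_differentiable[OF k(1)])
  qed
  show "laplacian u x < laplacian (\<lambda>x. log_barrier k A b (x \<bullet> x)) x" if "R < x \<bullet> x" for x
  proof -
    have "x \<bullet> x > 0" using that R by linarith
    then show ?thesis
      using super[of x] b[OF that] by (simp add: laplacian_log_barrier[OF k(1)])
  qed
qed

text \<open>The harmonic barrier (\<open>b = 0\<close>) is compared with \<open>u\<close> outside
  the unit ball; \<open>m\<close> is the minimum of \<open>u\<close> on the unit sphere.\<close>

lemma supersolution_lower_bound:
  "\<exists>m>0. \<forall>x. 1 \<le> x \<bullet> x \<longrightarrow> m * (x \<bullet> x) powr (- k / 2) \<le> u x"
proof -
  let ?S = "sphere (0 :: real^'n) 1"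
  have cont: "continuous_on ?S u"
    using C2 by (auto simp: C2_function_def C1_function_def intro: continuous_on_subset)
  have "axis undefined 1 \<in> ?S" by simp
  then obtain z where z: "z \<in> ?S" "\<And>x. x \<in> ?S \<Longrightarrow> u z \<le> u x"
    using continuous_attains_inf[OF compact_sphere _ cont] by blast
  have "u z * (x \<bullet> x) powr (- k / 2) \<le> u x" if "1 \<le> x \<bullet> x" for x
  proof -
    have "log_barrier k (u z) 0 (x \<bullet> x) \<le> u x"
    proof (rule supersolution_ge_log_barrier[OF _ _ _ that])
      show "log_barrier k (u z) 0 1 \<le> u x" if "x \<bullet> x = 1" for x
        using z(2)[of x] that by (simp add: log_barrier_def norm_eq_sqrt_inner)
      show "2 * k * 0 * (x \<bullet> x) powr (- (k + 2) / 2) < c * u x powr ((k + 2) / k)" for x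
        using c pos[of x] by simp
    qed simp
    then show ?thesis by (simp add: log_barrier_def mult.commute)
  qed
  with pos[of z] show ?thesis by blast
qed

text \<open>Here \<open>\<tau>\<close> is the logarithm of a squared radius. The assumption
  \<open>x \<noteq> 0\<close> keeps out the default value of \<open>ln\<close> at 0.\<close>

lemma supersolution_doubling:
  assumes m: "m > 0" and lower: "\<And>x. \<tau> \<le> ln (x \<bullet> x) \<Longrightarrow> x \<noteq> 0 \<Longrightarrow> m * (x \<bullet> x) powr (- k / 2) \<le> u x"
    and x: "x \<noteq> 0" "\<tau> + 4 * k / c * m powr (- 2 / k) \<le> ln (x \<bullet> x)"
  shows "2 * m * (x \<bullet> x) powr (- k / 2) \<le> u x"
proof -
  \<comment> \<open>This makes 2 k b half of c m^((k+2)/k); the factor one half gives the strict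
    inequality.\<close>
  define b where "b = c * m powr ((k + 2) / k) / (4 * k)"
  have b: "b > 0" using c k m by (simp add: b_def)
  \<comment> \<open>This is where criticality enters: the critical power of |x|^(-k) is |x|^(-N),
    exactly the decay of the Laplacian of the barrier.\<close>
  have exponent: "- k / 2 * ((k + 2) / k) = - (k + 2) / 2" using k by (simp add: field_simps)
  \<comment> \<open>The shift by \<open>b * \<tau>\<close> makes the barrier equal to m |x|^(-k) on
    the sphere where \<open>ln (x \<bullet> x) = \<tau>\<close>.\<close>
  have low: "log_barrier k (m - b * \<tau>) b (x \<bullet> x) \<le> u x"
  proof (rule supersolution_ge_log_barrier[of "exp \<tau>"])
    show "log_barrier k (m - b * \<tau>) b (exp \<tau>) \<le> u x" if "x \<bullet> x = exp \<tau>" for x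
    proof -
      have "x \<noteq> 0" using that exp_gt_zero[of \<tau>] by auto
      then show ?thesis using lower[of x] that by (simp add: log_barrier_def mult.commute)
    qed
    show "2 * k * b * (x \<bullet> x) powr (- (k + 2) / 2) < c * u x powr ((k + 2) / k)"
      if "exp \<tau> < x \<bullet> x" for x
    proof -
      have xpos: "x \<bullet> x > 0" using that exp_gt_zero[of \<tau>] by linarith
      then have "\<tau> \<le> ln (x \<bullet> x)" using that by (simp add: ln_ge_iff)
      then have "m * (x \<bullet> x) powr (- k / 2) \<le> u x" using lower xpos by auto
      then have "(m * (x \<bullet> x) powr (- k / 2)) powr ((k + 2) / k) \<le> u x powr ((k + 2) / k)"
        using m k by (intro powr_mono2) auto
      moreover have "(m * (x \<bullet> x) powr (- k / 2)) powr ((k + 2) / k)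
          = m powr ((k + 2) / k) * (x \<bullet> x) powr (- (k + 2) / 2)"
        by (simp only: powr_mult powr_powr exponent)
      ultimately have "c * (m powr ((k + 2) / k) * (x \<bullet> x) powr (- (k + 2) / 2)) \<le> c * u x powr ((k + 2) / k)"
        using c by simp
      moreover have "2 * k * b * (x \<bullet> x) powr (- (k + 2) / 2)
          = c * (m powr ((k + 2) / k) * (x \<bullet> x) powr (- (k + 2) / 2)) / 2"
        using k by (simp add: b_def)
      moreover have "0 < c * (m powr ((k + 2) / k) * (x \<bullet> x) powr (- (k + 2) / 2))"
        using c m xpos by simp
      ultimately show ?thesis by linarith
    qed
    have "0 \<le> 4 * k / c * m powr (- 2 / k)" using c k by simp
    with x have "\<tau> \<le> ln (x \<bullet> x)" by linarith
    then show "exp \<tau> \<le> x \<bullet> x" using x by (simp add: ln_ge_iff)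
  qed simp
  \<comment> \<open>The required increase of the logarithm is m / b, so \<open>b * ln\<close> gains
    at least another \<open>m\<close>.\<close>
  have "(k + 2) / k = 1 + 2 / k" using k by (simp add: field_simps)
  then have "b * (4 * k / c * m powr (- 2 / k)) = m"
    using c k m by (simp add: b_def powr_add powr_minus)
  moreover have "b * (4 * k / c * m powr (- 2 / k)) \<le> b * (ln (x \<bullet> x) - \<tau>)"
    using x b by (intro mult_left_mono) auto
  ultimately have "2 * m \<le> m - b * \<tau> + b * ln (x \<bullet> x)" by (simp add: algebra_simps)
  then have "2 * m * (x \<bullet> x) powr (- k / 2) \<le> log_barrier k (m - b * \<tau>) b (x \<bullet> x)"
    unfolding log_barrier_def by (subst mult.commute, intro mult_left_mono) auto
  with low show ?thesis by linarith
qed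

text \<open>Each doubling of \<open>m\<close> multiplies the next increment of the logarithm by
  \<open>r < 1\<close>, so all the doublings are available at one fixed point.\<close>

lemma critical_supersolution_False: False
proof -
  obtain m where m: "m > 0" "\<And>x. 1 \<le> x \<bullet> x \<Longrightarrow> m * (x \<bullet> x) powr (- k / 2) \<le> u x"
    using supersolution_lower_bound by blast
  define r where "r = (2::real) powr (- 2 / k)"
  have r: "0 < r" "r < 1" using k by (auto simp: r_def powr_less_one)
  \<comment> \<open>The sum of the geometric series of increments; the first j of them sum to
    \<open>E * (1 - r ^ j)\<close>.\<close>
  define E where "E = 4 * k / c * m powr (- 2 / k) / (1 - r)"
  have bound: "2 ^ j * m * (x \<bullet> x) powr (- k / 2) \<le> u x"
    if "x \<noteq> 0" "E * (1 - r ^ j) \<le> ln (x \<bullet> x)" for j x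
    using that
  proof (induction j arbitrary: x)
    case 0
    then show ?case using m(2)[of x] by simp
  next
    case (Suc j)
    have "(2 ^ j * m) powr (- 2 / k) = r ^ j * m powr (- 2 / k)"
      using m by (simp add: powr_mult r_def powr_powr powr_realpow [symmetric] mult.commute)
    moreover have "4 * k / c * m powr (- 2 / k) = E * (1 - r)" using r by (simp add: E_def)
    ultimately have "4 * k / c * (2 ^ j * m) powr (- 2 / k) = E * (1 - r) * r ^ j"
      by (metis mult.assoc mult.commute)
    then have "E * (1 - r ^ j) + 4 * k / c * (2 ^ j * m) powr (- 2 / k) = E * (1 - r ^ Suc j)"
      by (simp add: algebra_simps)
    with Suc supersolution_doubling[of "2 ^ j * m" "E * (1 - r ^ j)" x] m(1)
    show ?case by (simp add: mult.assoc)
  qed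
  have E: "E > 0" using c k m r by (simp add: E_def)
  define x :: "real^'n" where "x = exp (E / 2) *\<^sub>R axis undefined 1"
  have xx: "x \<bullet> x = exp E"
    by (simp add: x_def inner_axis_axis exp_add [symmetric])
  have "2 ^ j * (m * exp E powr (- k / 2)) \<le> u x" for j
  proof -
    have "E * (1 - r ^ j) \<le> E" using E r by simp
    moreover have "x \<noteq> 0" by (simp add: x_def)
    ultimately show ?thesis using bound[of x j] xx by (simp add: mult.assoc)
  qed
  moreover obtain j :: nat where "u x / (m * exp E powr (- k / 2)) < 2 ^ j"
    using real_arch_pow[of 2] by auto
  then have "u x < 2 ^ j * (m * exp E powr (- k / 2))"
    using m by (simp add: pos_divide_less_eq)
  ultimately show False by (meson not_le)
qed

end

section \<open>The system\<close>

lemma bounded_above_if_tendsto_0_at_infinity: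
  fixes f :: "'a::euclidean_space \<Rightarrow> real"
  assumes cont: "continuous_on UNIV f" and lim: "(f \<longlongrightarrow> 0) at_infinity"
  shows "\<exists>M>0. \<forall>x. f x \<le> M"
proof -
  have "eventually (\<lambda>x. f x < 1) at_infinity"
    using lim by (rule order_tendstoD) simp
  then obtain b where b: "\<And>x. b \<le> norm x \<Longrightarrow> f x < 1"
    by (auto simp: eventually_at_infinity)
  have "bounded (f ` cball 0 b)"
    by (intro compact_imp_bounded compact_continuous_image continuous_on_subset[OF cont]) auto
  then obtain M where M: "\<forall>x\<in>cball 0 b. \<bar>f x\<bar> \<le> M"
    by (auto simp: bounded_iff)
  have "f x \<le> max 1 M" for x
  proof (cases "norm x \<le> b")
    case True
    then show ?thesis using bspec[OF M, of x] by auto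
  next
    case False
    then show ?thesis using b[of x] by auto
  qed
  then show ?thesis by (intro exI[of _ "max 1 M"]) auto
qed

text \<open>Let P be the critical exponent and M, V upper bounds of u, v. As p - P is not positive,
  u^(p-P) is at least M^(p-P), so u^p / v^q dominates M^(p-P) V^(-q) u^P; the term
  \<open>\<rho>\<close> only helps.\<close>

lemma no_positive_solution_subcritical:
  fixes u v \<rho> :: "real^'n::finite \<Rightarrow> real"
  assumes k: "real CARD('n) = k + 2" "k > 0"
    and p: "p \<le> (k + 2) / k" and q: "q > 0" and \<rho>: "\<And>x. \<rho> x \<ge> 0"
  shows "\<not> positive_solution p q m s \<rho> u v"
proof
  assume "positive_solution p q m s \<rho> u v"
  then have C2: "C2_function u" "C2_function v" and pos: "\<And>x. u x > 0" "\<And>x. v x > 0"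
    and lim: "(u \<longlongrightarrow> 0) at_infinity" "(v \<longlongrightarrow> 0) at_infinity"
    and equ: "\<And>x. - laplacian u x = u x powr p / v x powr q + \<rho> x"
    by (auto simp: positive_solution_def)
  obtain M where M: "M > 0" "\<And>x. u x \<le> M"
    using bounded_above_if_tendsto_0_at_infinity[OF _ lim(1)] C2
    by (auto simp: C2_function_def C1_function_def)
  obtain V where V: "V > 0" "\<And>x. v x \<le> V"
    using bounded_above_if_tendsto_0_at_infinity[OF _ lim(2)] C2
    by (auto simp: C2_function_def C1_function_def)
  define P where "P = (k + 2) / k"
  define c where "c = M powr (p - P) / V powr q"
  show False
  proof (rule critical_supersolution_False[OF k _ C2(1) pos(1) lim(1)])
    show "c > 0" using M V by (simp add: c_def)
    show "c * u x powr ((k + 2) / k) \<le> - laplacian u x" for x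
    proof -
      have "M powr (p - P) * u x powr P \<le> u x powr (p - P) * u x powr P"
        using p pos[of x] M(2)[of x] by (intro mult_right_mono powr_mono2') (auto simp: P_def)
      also have "\<dots> = u x powr p" by (simp add: powr_add [symmetric])
      finally have "M powr (p - P) * u x powr P / V powr q \<le> u x powr p / v x powr q"
        using pos[of x] V q by (intro frac_le powr_mono2) auto
      then show ?thesis using equ[of x] \<rho>[of x] by (simp add: c_def P_def)
    qed
  qed
qed

section \<open>Powers of 1 + |x|^2\<close>

text \<open>For e = (N-2)/2 this is the extremal profile of the Sobolev inequality.\<close>

definition power_profile :: "real \<Rightarrow> real \<Rightarrow> real^'n::finite \<Rightarrow> real" where
  "power_profile A e x = A * (1 + x \<bullet> x) powr (- e)"

lemma one_plus_inner_pos [simp]: "0 < 1 + x \<bullet> (x :: 'a::real_inner)"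
  by (simp add: add_pos_nonneg)

lemma power_profile_pos: "A > 0 \<Longrightarrow> power_profile A e x > 0"
  by (simp add: power_profile_def add_pos_nonneg less_imp_neq[symmetric])

lemma powr_minus_diff_1:
  fixes z e :: real
  assumes "z > 0"
  shows "z powr (- e - 1) = z * z powr (- e - 2)"
proof -
  have "1 + (- e - 2) = - e - 1" by simp
  then show ?thesis using powr_mult_base[of z "- e - 2"] assms by (metis less_imp_le)
qed

text \<open>Both terms of the radial formula are put over the common power \<open>- e - 2\<close>.
  For 0 < e < (N-2)/2 the last factor is positive and grows like |x|^2; at e = (N-2)/2 it is
  constant.\<close>

lemma
  fixes x :: "real^'n::finite"
  shows C2_function_power_profile: "C2_function (power_profile A e :: real^'n \<Rightarrow> real)"
    and laplacian_power_profile: "laplacian (power_profile A e) x =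
      - (2 * e * A * (1 + x \<bullet> x) powr (- e - 2) * (real CARD('n) + (real CARD('n) - 2 - 2 * e) * (x \<bullet> x)))"
proof -
  define G where "G y = A * (1 + y) powr (- e)" for y :: real
  define G' where "G' y = - e * A * (1 + y) powr (- e - 1)" for y :: real
  define G'' where "G'' y = e * (e + 1) * A * (1 + y) powr (- e - 2)" for y :: real
  have G': "(G has_real_derivative G' y) (at y)" if "y \<in> {-1<..}" for y
    using that unfolding G_def [abs_def] G'_def
    by (auto intro!: derivative_eq_intros simp: field_simps)
  have G'': "(G' has_real_derivative G'' y) (at y)" if "y \<in> {-1<..}" for y
  proof -
    have "- e - 2 = - e - 1 - 1" by simp
    then show ?thesis
      using that unfolding G'_def [abs_def] G''_def
      by (auto intro!: derivative_eq_intros simp: algebra_simps)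
  qed
  have f: "power_profile A e = (\<lambda>x::real^'n. G (x \<bullet> x))"
    by (auto simp: power_profile_def G_def)
  have S: "x \<bullet> x \<in> {-1<..}" using inner_ge_zero[of x] by (simp add: less_le_trans[of _ 0])
  have "continuous_on {-1<..} G''"
    unfolding G''_def [abs_def] by (intro continuous_intros) auto
  then show "C2_function (power_profile A e :: real^'n \<Rightarrow> real)"
    unfolding f by (intro C2_function_radial[OF _ G' G'']) auto
  define z where "z = 1 + x \<bullet> x"
  have z: "z > 0" by (simp add: z_def)
  have pw: "z powr (- e - 1) = z * z powr (- e - 2)"
    using z by (rule powr_minus_diff_1)
  have "laplacian (power_profile A e) x = 2 * real CARD('n) * G' (x \<bullet> x) + 4 * (x \<bullet> x) * G'' (x \<bullet> x)"
    unfolding f by (rule laplacian_radial[OF open_greaterThan G' G'' S])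
  also have "\<dots> = - (2 * e * A * z powr (- e - 2) *
      (real CARD('n) * z - 2 * (e + 1) * (x \<bullet> x)))"
    by (simp add: G'_def G''_def z_def [symmetric] pw algebra_simps)
  also have "real CARD('n) * z - 2 * (e + 1) * (x \<bullet> x) = real CARD('n) + (real CARD('n) - 2 - 2 * e) * (x \<bullet> x)"
    by (simp add: z_def algebra_simps)
  finally show "laplacian (power_profile A e) x =
      - (2 * e * A * (1 + x \<bullet> x) powr (- e - 2) * (real CARD('n) + (real CARD('n) - 2 - 2 * e) * (x \<bullet> x)))"
    by (simp add: z_def)
qed

lemma power_profile_tendsto_0:
  assumes "e > 0"
  shows "(power_profile A e \<longlongrightarrow> 0) at_infinity"
proof -
  have "((\<lambda>y::real. (1 + y) powr (- e)) \<longlongrightarrow> 0) at_top"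
    using assms by real_asymp
  from tendsto_mult_right_zero[OF filterlim_compose[OF this filterlim_inner_self_at_infinity]]
  show ?thesis unfolding power_profile_def [abs_def] .
qed

lemma power_profile_powr:
  "A > 0 \<Longrightarrow> power_profile A e x powr r = A powr r * (1 + x \<bullet> x) powr (- e * r)"
  by (simp add: power_profile_def powr_mult powr_powr)

section \<open>Construction of a solution above the critical exponent\<close>

lemma positive_solution_supercritical:
  fixes k p :: real
  assumes k: "real CARD('n::finite) = k + 2" "k > 0" and p: "p > (k + 2) / k"
  shows "\<exists>q m s. \<exists>\<rho> :: real^'n \<Rightarrow> real.
               q > 0 \<and> m > 0 \<and> s > 0 \<and> continuous_on UNIV \<rho> \<and> (\<forall>x. \<rho> x \<ge> 0) \<and>
               (\<exists>u v. positive_solution p q m s \<rho> u v)"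
proof -
  have p1: "p - 1 > 2 / k" using p k by (simp add: field_simps)
  then have p1_pos: "p - 1 > 0" using k by (smt (verit) divide_pos_pos)
  \<comment> \<open>Supercriticality of \<open>p\<close> is exactly what leaves room for
    \<open>a\<close>.\<close>
  have "1 / (p - 1) < k / 2" using p1 p1_pos k by (simp add: field_simps)
  then obtain a where a: "1 / (p - 1) < a" "a < k / 2" using dense by blast
  have a_pos: "a > 0" using a p1_pos by (smt (verit) divide_pos_pos)
  have a1: "a * (p - 1) > 1" using a p1_pos by (simp add: field_simps)
  \<comment> \<open>The second bound makes u^p / v^q decay at least like (1+|x|^2)^(-a-1); together
    with it, q < 1 yields \<open>d > 0\<close>.\<close>
  define q where "q = min (1 / 2) ((a * (p - 1) - 1) * 2 / k)"
  have q: "q > 0" "q < 1" "q * k / 2 \<le> a * (p - 1) - 1"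
    using a1 k by (auto simp: q_def min_def field_simps)
  \<comment> \<open>Chosen so that u^m / v has the decay exponent - (k+2) + k/2 = - k/2 - 2 of
    -Laplace v.\<close>
  define m where "m = (k + 2) / a"
  have m: "m > 0" using k a_pos by (simp add: m_def)
  \<comment> \<open>With \<open>l\<close> proportional to K^(m/2), the product K^p l^(-q) is
    proportional to K^(1+d).\<close>
  define d where "d = p - 1 - m * q / 2"
  have "(k + 2) * q / 2 < a * (p - 1)" using q by (simp add: field_simps)
  then have d: "d > 0" using a_pos by (simp add: d_def m_def field_simps)
  \<comment> \<open>-Laplace u will be at least \<kappa> K (1+|x|^2)^(-a-1).\<close>
  define \<kappa> where "\<kappa> = 2 * a * (k - 2 * a)"
  have \<kappa>: "\<kappa> > 0" using a a_pos by (simp add: \<kappa>_def)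
  \<comment> \<open>The coefficient of -Laplace applied to (1+|x|^2)^(-k/2).\<close>
  define L where "L = k * (k + 2)"
  have L: "L > 0" using k by (simp add: L_def)
  \<comment> \<open>Solves K^d = \<kappa> L^(-q/2), so that the coefficient of u^p / v^q becomes
    exactly \<kappa> K.\<close>
  define K where "K = (\<kappa> * L powr (- q / 2)) powr (1 / d)"
  have K: "K > 0" using \<kappa> L by (simp add: K_def)
  have Kd: "K powr d = \<kappa> * L powr (- q / 2)" using d \<kappa> L by (simp add: K_def powr_powr)
  \<comment> \<open>Solves L l = K^m / l, the coefficient identity of the second equation with s =
    1.\<close>
  define l where "l = K powr (m / 2) * L powr (- 1 / 2)"
  have l: "l > 0" using K L by (simp add: l_def)
  have l2: "l * l * L = K powr m"
    using K L by (simp add: l_def powr_add [symmetric] powr_minus field_simps flip: powr_half_sqrt)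
  have lq: "K powr p * l powr (- q) = \<kappa> * K"
  proof -
    have "K powr p * l powr (- q) = K powr (p - m * q / 2) * L powr (q / 2)"
      using K L by (simp add: l_def powr_mult powr_powr powr_add [symmetric] algebra_simps)
    also have "K powr (p - m * q / 2) = K * K powr d"
      using K powr_mult_base[of K d] by (simp add: d_def algebra_simps)
    also have "\<dots> * L powr (q / 2) = \<kappa> * K"
      using L by (simp add: Kd powr_minus field_simps)
    finally show ?thesis .
  qed
  define u :: "real^'n \<Rightarrow> real" where "u = power_profile K a"
  define v :: "real^'n \<Rightarrow> real" where "v = power_profile l (k / 2)"
  \<comment> \<open>The first equation now holds by definition; what remains for
    \<open>\<rho>\<close> is nonnegativity and continuity.\<close>
  define \<rho> where "\<rho> x = - laplacian u x - u x powr p / v x powr q" for x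
  have quot: "u x powr p / v x powr q = \<kappa> * K * (1 + x \<bullet> x) powr (- a * p + q * k / 2)" for x
  proof -
    have "u x powr p / v x powr q = u x powr p * v x powr (- q)" by (simp add: powr_minus divide_inverse)
    also have "\<dots> = (K powr p * l powr (- q)) *
        ((1 + x \<bullet> x) powr (- a * p) * (1 + x \<bullet> x) powr (- (k / 2) * - q))"
      using K l by (simp add: u_def v_def power_profile_powr)
    also have "(1 + x \<bullet> x) powr (- a * p) * (1 + x \<bullet> x) powr (- (k / 2) * - q) =
        (1 + x \<bullet> x) powr (- a * p + q * k / 2)"
      by (simp add: powr_add [symmetric] mult.commute)
    finally show ?thesis by (simp add: lq)
  qed
  have lap_u: "- laplacian u x = 2 * a * K * (1 + x \<bullet> x) powr (- a - 2) * ((k + 2) + (k - 2 * a) * (x \<bullet> x))" for x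
    using k by (simp add: u_def laplacian_power_profile)
  have "\<rho> x \<ge> 0" for x
  proof -
    have "u x powr p / v x powr q \<le> \<kappa> * K * (1 + x \<bullet> x) powr (- a - 1)"
      unfolding quot using q \<kappa> K by (intro mult_left_mono powr_mono) (auto simp: algebra_simps)
    also have "(1 + x \<bullet> x) powr (- a - 1) = (1 + x \<bullet> x) powr (- a - 2) * (1 + x \<bullet> x)"
      by (subst powr_minus_diff_1) (simp_all only: one_plus_inner_pos mult.commute)
    also have "\<kappa> * K * \<dots> = 2 * a * K * (1 + x \<bullet> x) powr (- a - 2) * ((k - 2 * a) * (1 + x \<bullet> x))"
      by (simp add: \<kappa>_def)
    \<comment> \<open>Uses k - 2 a \<le> k + 2 in the constant term.\<close>
    also have "\<dots> \<le> - laplacian u x"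
      unfolding lap_u using a a_pos K
      by (intro mult_left_mono) (auto simp: algebra_simps)
    finally show ?thesis by (simp add: \<rho>_def)
  qed
  moreover have "continuous_on UNIV \<rho>"
    unfolding \<rho>_def [abs_def] quot lap_u by (intro continuous_intros) (auto simp: less_imp_neq[symmetric])
  moreover have "positive_solution p q m 1 \<rho> u v"
    unfolding positive_solution_def
  proof (intro conjI allI)
    show "C2_function u" "C2_function v"
      by (simp_all add: u_def v_def C2_function_power_profile)
    show "u x > 0" "v x > 0" for x
      using K l by (simp_all add: u_def v_def power_profile_pos)
    show "(u \<longlongrightarrow> 0) at_infinity" "(v \<longlongrightarrow> 0) at_infinity"
      using a_pos k by (simp_all add: u_def v_def power_profile_tendsto_0)
    show "- laplacian u x = u x powr p / v x powr q + \<rho> x" for x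
      by (simp add: \<rho>_def)
    show "- laplacian v x = u x powr m / v x powr 1" for x
    proof -
      have am: "a * m = k + 2" using a_pos by (simp add: m_def)
      have "- laplacian v x = L * l * (1 + x \<bullet> x) powr (- k / 2 - 2)"
        using k by (simp add: v_def laplacian_power_profile L_def)
      also have "- k / 2 - 2 = - a * m - (- k / 2)" using am by simp
      also have "L * l * (1 + x \<bullet> x) powr (- a * m - (- k / 2)) =
          (l * l * L) * (1 + x \<bullet> x) powr (- a * m) / (l * (1 + x \<bullet> x) powr (- k / 2))"
        by (simp only: powr_diff) (use l in simp)
      also have "\<dots> = u x powr m / v x powr 1"
        using K power_profile_pos[OF l, of "k / 2" x]
        by (simp add: l2 u_def v_def power_profile_powr power_profile_def[of l])
      finally show ?thesis .
    qed
  qed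
  ultimately show ?thesis using q m zero_less_one by blast
qed

theorem corollary1p6:
  fixes N :: real
  assumes "CARD('n::finite) \<ge> 3"
    and "N = real CARD('n)"
  shows "(\<forall>p. 0 < p \<and> p \<le> N / (N - 2) \<longrightarrow>
            (\<forall>q m s. \<forall>\<rho> :: real^'n \<Rightarrow> real.
               q > 0 \<and> m > 0 \<and> s > 0 \<and> continuous_on UNIV \<rho> \<and> (\<forall>x. \<rho> x \<ge> 0) \<longrightarrow>
               \<not> (\<exists>u v. positive_solution p q m s \<rho> u v)))
       \<and> (\<forall>p. p > N / (N - 2) \<longrightarrow>
            (\<exists>q m s. \<exists>\<rho> :: real^'n \<Rightarrow> real.
               q > 0 \<and> m > 0 \<and> s > 0 \<and> continuous_on UNIV \<rho> \<and> (\<forall>x. \<rho> x \<ge> 0) \<and>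
               (\<exists>u v. positive_solution p q m s \<rho> u v)))"
proof -
  \<comment> \<open>Both halves are instantiated with k = N - 2.\<close>
  have k: "real CARD('n) = (N - 2) + 2" "N - 2 > 0" using assms by auto
  have N: "N / (N - 2) = ((N - 2) + 2) / (N - 2)" by simp
  show ?thesis
    unfolding N using no_positive_solution_subcritical[OF k] positive_solution_supercritical[OF k]
    by blast
qed

end
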